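(* Let $\mathbf{c}=(c_n)_{n\in\mathbb{N}}$ be an oscillating sequence of complex numbers. Let $I=[a,b]\subset\mathbb{R}$ be a closed interval and let $f:I\to I$ be a continuous map with zero topological entropy. Then $\mathbf{c}$ is linearly disjoint from the flow $\mathcal{X}=\{f^n:I\to I\}_{n\in\{0\}\cup\mathbb{N}}$ generated by $f$, that is, $$\lim_{N\to\infty}\frac1N\sum_{n=1}^N c_n\,\varphi(f^nx)=0$$ for every continuous function $\varphi:I\to\mathbb{C}$ and every $x\in I$.
   Context: Here $\mathbb{N}=\{1,2,3,\dots\}$ and $f^n$ denotes the $n$-th iterate of $f$. Oscillating sequence: a sequence $\mathbf{c}=(c_n)_{n\in\mathbb{N}}$ of complex numbers is oscillating if there is a constant $\lambda>1$ such that $$\lim_{N\to\infty}\frac1N\sum_{n=1}^N|c_n|^{\lambda}<\infty$$ and $$\lim_{N\to\infty}\frac1N\sum_{n=1}^N c_n e^{2\pi i n t}=0\quad\text{for all } 0\le t<1.$$ *)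

theory Defs
  imports "HOL-Analysis.Analysis"
begin

text \<open>Sequences are indexed by \<open>{1, 2, 3, \<dots>}\<close>: the value \<open>c 0\<close> is never used.
  A limit of nonnegative averages being finite means convergence in the reals.\<close>

definition oscillating :: "(nat \<Rightarrow> complex) \<Rightarrow> bool" where
  "oscillating c \<longleftrightarrow>
     (\<exists>l::real. l > 1 \<and> convergent (\<lambda>N. (\<Sum>n=1..N. cmod (c n) powr l) / real N)) \<and>
     (\<forall>t\<in>{0..<1::real}.
        (\<lambda>N. (\<Sum>n=1..N. c n * exp (2 * of_real pi * \<i> * of_nat n * of_real t)) / of_nat N)
          \<longlonglongrightarrow> 0)"

text \<open>Bowen's definition of topological entropy for a continuous self-map \<open>f\<close> of a
  compact set \<open>X\<close> in a metric space.\<close>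

definition separated :: "'a::metric_space set \<Rightarrow> ('a \<Rightarrow> 'a) \<Rightarrow> nat \<Rightarrow> real \<Rightarrow> 'a set \<Rightarrow> bool" where
  "separated X f n \<epsilon> E \<longleftrightarrow>
     E \<subseteq> X \<and> (\<forall>x\<in>E. \<forall>y\<in>E. x \<noteq> y \<longrightarrow> (\<exists>k<n. dist ((f ^^ k) x) ((f ^^ k) y) > \<epsilon>))"

text \<open>The inner supremum is \<open>ln (s n \<epsilon>) / n\<close>, where \<open>s n \<epsilon>\<close> is the largest cardinality of
  an \<open>(n, \<epsilon>)\<close>-separated set; taking it in \<^typ>\<open>ereal\<close> avoids presupposing that this
  maximum exists. The empty set contributes \<open>0\<close>, since \<open>ln 0 = 0\<close>. The \<open>limsup\<close> is
  antitone in \<open>\<epsilon>\<close>, so the outer supremum is the limit for \<open>\<epsilon> \<rightarrow> 0\<close>.\<close>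

definition topological_entropy :: "'a::metric_space set \<Rightarrow> ('a \<Rightarrow> 'a) \<Rightarrow> ereal" where
  "topological_entropy X f =
     (SUP \<epsilon>\<in>{0<..}. limsup (\<lambda>n. SUP E\<in>{E. finite E \<and> separated X f n \<epsilon> E}.
        ereal (ln (real (card E)) / real n)))"

definition linearly_disjoint ::
    "(nat \<Rightarrow> complex) \<Rightarrow> 'a::topological_space set \<Rightarrow> ('a \<Rightarrow> 'a) \<Rightarrow> bool" where
  "linearly_disjoint c X f \<longleftrightarrow>
     (\<forall>\<phi>::'a \<Rightarrow> complex. continuous_on X \<phi> \<longrightarrow>
        (\<forall>x\<in>X. (\<lambda>N. (\<Sum>n=1..N. c n * \<phi> ((f ^^ n) x)) / of_nat N) \<longlonglongrightarrow> 0))"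

end

theory Submission
  imports Defs
begin

text \<open>A map with zero entropy has no horseshoe: there are no points \<open>p < q < r\<close> such that both \<open>[p, q]\<close>
  and \<open>[q, r]\<close> are mapped over \<open>[p, r]\<close> by some iterates. In the absence of horseshoes the points of
  an orbit that move up lie below the points that move down; a fixed point \<open>z\<close> separates them, and
  the orbit either converges or eventually alternates between the two sides of \<open>z\<close>. Applied to the
  iterates \<open>f\<^sup>M\<close> with \<open>M = 2\<^sup>k\<close>, this splits the interval repeatedly: the points of the orbit with time
  in a given residue class modulo \<open>M\<close> are eventually trapped in an interval, and the lengths of these
  \<open>M\<close> intervals add up to little more than \<open>b - a\<close>. Hence most of them are short, so the observed
  sequence is periodic with period \<open>M\<close> up to a small error, outside a few residue classes. Periodic
  sequences are combinations of exponentials, and the moment bound on \<open>c\<close> controls the exceptional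
  residue classes.\<close>

subsection \<open>Orbits of interval maps without horseshoes\<close>

text \<open>The two covering times may differ and the halves share the endpoint \<open>q\<close>.
  Horseshoes of this weak form arise directly from orbit points, and excluding them for
  \<open>g\<close> excludes them for every iterate of positive order.\<close>

locale horseshoe_free =
  fixes a b :: real and g :: "real \<Rightarrow> real"
  assumes cont: "continuous_on {a..b} g"
    and maps: "g \<in> {a..b} \<rightarrow> {a..b}"
    and no_horseshoe: "\<lbrakk>a \<le> p; p < q; q < r; r \<le> b; 0 < m; 0 < n;
      {p..r} \<subseteq> (g ^^ m) ` {p..q}; {p..r} \<subseteq> (g ^^ n) ` {q..r}\<rbrakk> \<Longrightarrow> False"

section \<open>Iterates, coverings and reflection\<close>

lemma funpow_in: "(f ^^ n) x \<in> X" if "f \<in> X \<rightarrow> X" "x \<in> X"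
  using that by (induction n) auto

lemma continuous_on_funpow:
  fixes f :: "'a::topological_space \<Rightarrow> 'a"
  assumes "continuous_on X f" "f \<in> X \<rightarrow> X"
  shows "continuous_on X (f ^^ n)"
proof (induction n)
  case 0
  show ?case by (simp add: id_def)
next
  case (Suc n)
  have "(f ^^ n) ` X \<subseteq> X"
    using funpow_in[OF assms(2)] by blast
  then show ?case
    using continuous_on_compose[OF Suc continuous_on_subset[OF assms(1)]] by (simp add: o_def)
qed

lemma funpow_covers_trans:
  assumes "S \<subseteq> (g ^^ m) ` T" "R \<subseteq> (g ^^ n) ` S"
  shows "R \<subseteq> (g ^^ (n + m)) ` T"
  using assms by (force simp: funpow_add)

lemma funpow_uminus_conj:
  fixes g :: "'a::group_add \<Rightarrow> 'a"
  shows "((\<lambda>t. - g (- t)) ^^ n) t = - (g ^^ n) (- t)"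
  by (induction n) auto

lemma image_uminus_conj:
  fixes g :: "real \<Rightarrow> real"
  shows "((\<lambda>t. - g (- t)) ^^ n) ` {p..q} = uminus ` (g ^^ n) ` {-q..-p}"
proof -
  have "uminus ` (g ^^ n) ` {-q..-p} = uminus ` (g ^^ n) ` uminus ` {p..q}" by simp
  also have "\<dots> = ((\<lambda>t. - g (- t)) ^^ n) ` {p..q}"
    unfolding image_image by (intro image_cong) (simp_all add: funpow_uminus_conj)
  finally show ?thesis by simp
qed

context horseshoe_free
begin

lemma iterate_in: "x \<in> {a..b} \<Longrightarrow> (g ^^ n) x \<in> {a..b}"
  using funpow_in[OF maps] .

text \<open>The intermediate value theorem in both orientations: a covering only has to be checked
  at the two endpoints.\<close>

lemma covers:
  assumes "u \<le> v" "a \<le> u" "v \<le> b"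
    and "(g ^^ n) u \<le> s \<and> t \<le> (g ^^ n) v \<or> (g ^^ n) v \<le> s \<and> t \<le> (g ^^ n) u"
  shows "{s..t} \<subseteq> (g ^^ n) ` {u..v}"
proof
  fix y assume y: "y \<in> {s..t}"
  have c: "continuous_on {u..v} (g ^^ n)"
    using continuous_on_subset[OF continuous_on_funpow[OF cont maps]] assms by auto
  show "y \<in> (g ^^ n) ` {u..v}"
    using assms(4)
  proof
    assume "(g ^^ n) u \<le> s \<and> t \<le> (g ^^ n) v"
    with IVT'[of "g ^^ n" u y v] y assms(1) c show ?thesis by force
  next
    assume "(g ^^ n) v \<le> s \<and> t \<le> (g ^^ n) u"
    with IVT2'[of "g ^^ n" v y u] y assms(1) c show ?thesis by force
  qed
qed

text \<open>Conjugation with negation swaps the two halves of a horseshoe. It turns ascents into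
  descents, so each one-sided result below gives its counterpart.\<close>

lemma mirror: "horseshoe_free (- b) (- a) (\<lambda>t. - g (- t))"
proof
  show "continuous_on {- b..- a} (\<lambda>t. - g (- t))"
    by (intro continuous_on_minus continuous_on_compose2[OF cont] continuous_on_id) auto
  show "(\<lambda>t. - g (- t)) \<in> {- b..- a} \<rightarrow> {- b..- a}"
    using maps by force
  fix p q r :: real and m n :: nat
  assume "- b \<le> p" "p < q" "q < r" "r \<le> - a" "0 < m" "0 < n"
    and "{p..r} \<subseteq> ((\<lambda>t. - g (- t)) ^^ m) ` {p..q}"
    and "{p..r} \<subseteq> ((\<lambda>t. - g (- t)) ^^ n) ` {q..r}"
  moreover from this(7,8) have "uminus ` {p..r} \<subseteq> (g ^^ m) ` {-q..-p}"
    "uminus ` {p..r} \<subseteq> (g ^^ n) ` {-r..-q}"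
    unfolding image_uminus_conj by (auto simp del: image_uminus_atLeastAtMost)
  ultimately show False
    using no_horseshoe[of "-r" "-q" "-p" n m] by simp
qed

text \<open>The last point \<open>y\<^sub>k > c\<close> before the orbit reaches \<open>c = y\<^sub>n\<close>, from which it jumps over \<open>w\<close>,
  splits \<open>[c, w]\<close> into a horseshoe.\<close>

lemma no_jump_after_descent:
  assumes y: "y \<in> {a..b}" and "y \<le> w" "w \<le> b" "w \<le> g w"
    and below: "\<And>j. j \<le> n \<Longrightarrow> (g ^^ j) y < w"
    and less: "(g ^^ n) y < y" and jump: "w \<le> (g ^^ Suc n) y"
  shows False
proof -
  let ?c = "(g ^^ n) y"
  define k where "k = (GREATEST k. k \<le> n \<and> ?c < (g ^^ k) y)"
  have k: "k \<le> n \<and> ?c < (g ^^ k) y" and k_max: "\<And>j. j \<le> n \<and> ?c < (g ^^ j) y \<Longrightarrow> j \<le> k"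
    unfolding k_def
    using GreatestI_nat[of "\<lambda>k. k \<le> n \<and> ?c < (g ^^ k) y" 0 n]
      Greatest_le_nat[of "\<lambda>k. k \<le> n \<and> ?c < (g ^^ k) y" _ n] less by auto
  have "k < n" using k by (cases "k = n") auto
  then have Sk: "(g ^^ Suc k) y \<le> ?c"
    using k_max[of "Suc k"] by force
  have in_I: "?c \<in> {a..b}" "(g ^^ k) y \<in> {a..b}" using iterate_in[OF y] by auto
  have kw: "(g ^^ k) y < w" using below k by simp
  have "{?c..w} \<subseteq> (g ^^ 1) ` {?c..(g ^^ k) y}"
    using k in_I Sk jump by (intro covers) auto
  moreover have "{?c..w} \<subseteq> (g ^^ 1) ` {(g ^^ k) y..w}"
    using k kw in_I Sk \<open>w \<le> g w\<close> \<open>w \<le> b\<close> by (intro covers) auto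
  ultimately show False
    using no_horseshoe[of ?c "(g ^^ k) y" w 1 1] k kw in_I \<open>w \<le> b\<close> by auto
qed

text \<open>Suppose the later ascent starts above \<open>y = (g ^^ i) x\<close>, and let
  \<open>w\<close> be the lowest point of \<open>[y, (g ^^ j) x]\<close> that is not moved down. All
  points of \<open>[y, w)\<close> move down, so the orbit of \<open>y\<close> can first reach
  \<open>w\<close> or pass it only from a point below \<open>y\<close>. That is the jump excluded by
  \<open>no_jump_after_descent\<close>.\<close>

lemma no_descent_then_ascent_above:
  assumes x: "x \<in> {a..b}" and "i < j"
    and D: "(g ^^ Suc i) x < (g ^^ i) x" and U: "(g ^^ j) x < (g ^^ Suc j) x"
  shows "(g ^^ j) x \<le> (g ^^ i) x"
proof (rule ccontr)
  assume "\<not> ?thesis"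
  then have less: "(g ^^ i) x < (g ^^ j) x" by simp
  define y where "y = (g ^^ i) x"
  have y: "y \<in> {a..b}" unfolding y_def using iterate_in[OF x] .
  have iter: "(g ^^ l) y = (g ^^ (l + i)) x" for l by (simp add: y_def funpow_add)
  let ?K = "{t \<in> {y..(g ^^ j) x}. t \<le> g t}"
  have "(g ^^ j) x \<in> {a..b}" using iterate_in[OF x] .
  then have sub: "{y..(g ^^ j) x} \<subseteq> {a..b}" using y by auto
  have "closed ?K"
    by (intro continuous_on_closed_Collect_le
        continuous_on_subset[OF cont sub] continuous_on_id closed_atLeastAtMost)
  moreover have "bounded ?K" by (rule bounded_subset[of "{y..(g ^^ j) x}"]) auto
  ultimately have "compact ?K" by (simp add: compact_eq_bounded_closed)
  moreover have "(g ^^ j) x \<in> ?K" using less U by (simp add: y_def)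
  ultimately obtain w where w: "w \<in> ?K" and w_min: "\<And>t. t \<in> ?K \<Longrightarrow> w \<le> t"
    using compact_attains_inf[of ?K] by blast
  have "g y < y" using D by (simp add: y_def)
  then have "y < w" using w by (cases "y = w") auto
  define n where "n = (LEAST n. w \<le> (g ^^ n) y)"
  have "w \<le> (g ^^ (j - i)) y" using w \<open>i < j\<close> by (simp add: iter)
  then have n: "w \<le> (g ^^ n) y" unfolding n_def by (rule LeastI)
  have below: "(g ^^ l) y < w" if "l < n" for l
    using not_less_Least[of l "\<lambda>n. w \<le> (g ^^ n) y"] that unfolding n_def by auto
  obtain m where m: "n = Suc m" using n \<open>y < w\<close> by (cases n) auto
  \<comment> \<open>Otherwise this point would lie in \<open>[y, w)\<close> without moving down,
    against the minimality of \<open>w\<close>.\<close>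
  have "(g ^^ m) y < y"
  proof (rule ccontr)
    assume "\<not> ?thesis"
    moreover have "(g ^^ m) y < w" using below m by simp
    moreover have "(g ^^ m) y \<le> g ((g ^^ m) y)" using n m calculation(2) by simp
    ultimately have "(g ^^ m) y \<in> ?K" using w by auto
    then show False using w_min \<open>(g ^^ m) y < w\<close> by force
  qed
  then show False
    using no_jump_after_descent[of y w m] y w sub below m n \<open>y < w\<close> by auto
qed

text \<open>Reflection exchanges the two possible orders of the times \<open>i\<close> and
  \<open>j\<close>. Equality is impossible because one point cannot move both up and down.\<close>

lemma ascents_below_descents:
  assumes x: "x \<in> {a..b}"
    and D: "(g ^^ Suc i) x < (g ^^ i) x" and U: "(g ^^ j) x < (g ^^ Suc j) x"
  shows "(g ^^ j) x < (g ^^ i) x"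
proof -
  have "(g ^^ j) x \<noteq> (g ^^ i) x" using D U by auto
  moreover have "(g ^^ j) x \<le> (g ^^ i) x"
  proof (cases i j rule: linorder_cases)
    case less
    then show ?thesis using no_descent_then_ascent_above[OF x _ D U] by simp
  next
    case equal
    then show ?thesis by simp
  next
    case greater
    interpret m: horseshoe_free "- b" "- a" "\<lambda>t. - g (- t)" by (rule mirror)
    show ?thesis
      using m.no_descent_then_ascent_above[of "- x" j i] x greater D U
      by (simp only: funpow_uminus_conj) auto
  qed
  ultimately show ?thesis by simp
qed

end

section \<open>Orbits on both sides of a fixed point\<close>

locale horseshoe_free_orbit = horseshoe_free +
  fixes x z :: real
  assumes x: "x \<in> {a..b}" and z: "z \<in> {a..b}" "g z = z"
    and ascent: "(g ^^ n) x < z \<Longrightarrow> (g ^^ n) x < (g ^^ Suc n) x"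
    and descent: "z < (g ^^ n) x \<Longrightarrow> (g ^^ Suc n) x < (g ^^ n) x"
    and neq: "(g ^^ n) x \<noteq> z"
begin

lemma iter_z: "(g ^^ n) z = z"
  using z(2) by (induction n) auto

lemma iter_x: "(g ^^ m) ((g ^^ n) x) = (g ^^ (m + n)) x"
  by (simp add: funpow_add)

text \<open>Marks the last two times of a run below \<open>z\<close> that has length at least two.
  By \<open>ascent\<close> the orbit moves up at both of them.\<close>

definition last_double_ascent :: "nat \<Rightarrow> bool" where
  "last_double_ascent k \<longleftrightarrow> (g ^^ Suc k) x < z \<and> (g ^^ k) x < z \<and> z < (g ^^ Suc (Suc k)) x"

lemma in_I: "a \<le> (g ^^ n) x" "(g ^^ n) x \<le> b" "a \<le> z" "z \<le> b"
  using iterate_in[OF x, of n] z by auto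

text \<open>Write x_n for \<open>(g ^^ n) x\<close>. One step maps \<open>[x_k, x_(k+1)]\<close>
  over \<open>[x_(k+1), z]\<close>. If x_m were at most x_k, then \<open>m - Suc k\<close> steps
  would map \<open>[x_(k+1), z]\<close> over \<open>[x_k, z]\<close>, since \<open>z\<close> is
  fixed. Together these form a horseshoe with middle point x_(k+1).\<close>

lemma no_return_below_double_ascent:
  assumes k: "last_double_ascent k" and "k < m"
  shows "(g ^^ k) x < (g ^^ m) x"
proof (rule ccontr)
  assume "\<not> ?thesis"
  then have le: "(g ^^ m) x \<le> (g ^^ k) x" by simp
  note k = k[unfolded last_double_ascent_def]
  have asc: "(g ^^ k) x < (g ^^ Suc k) x" using ascent k by blast
  have "m \<noteq> Suc k" using le asc by auto
  then have "Suc k < m" using \<open>k < m\<close> by simp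
  have A: "{(g ^^ Suc k) x..z} \<subseteq> (g ^^ 1) ` {(g ^^ k) x..(g ^^ Suc k) x}"
    using k asc in_I by (intro covers) auto
  have B: "{(g ^^ k) x..z} \<subseteq> (g ^^ (m - Suc k)) ` {(g ^^ Suc k) x..z}"
    using k le in_I iter_z iter_x[of "m - Suc k" "Suc k"] \<open>Suc k < m\<close>
    by (intro covers) (auto simp del: funpow.simps)
  show False
    using no_horseshoe[OF _ asc _ _ _ _ funpow_covers_trans[OF A B] B] k in_I \<open>Suc k < m\<close>
    by auto
qed

text \<open>If x_l were at most x_(k+1), then \<open>[x_(k+1), z]\<close> would be mapped over
  \<open>[x_l, z]\<close> at time \<open>l - Suc k\<close>, because \<open>z\<close> is fixed. This
  is one half of a horseshoe on \<open>[x_l, z]\<close>; the case distinction supplies the middle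
  point and the other half.\<close>

lemma double_ascents_increase:
  assumes k: "last_double_ascent k" and l: "last_double_ascent l" and "k < l"
  shows "(g ^^ Suc k) x < (g ^^ l) x"
proof (rule ccontr)
  assume "\<not> ?thesis"
  then have le: "(g ^^ l) x \<le> (g ^^ Suc k) x" by simp
  note k = k[unfolded last_double_ascent_def] and l = l[unfolded last_double_ascent_def]
  have "l \<noteq> Suc k" "l \<noteq> Suc (Suc k)" using k l by auto
  then have kl: "Suc (Suc k) < l" using \<open>k < l\<close> by simp
  have asc: "(g ^^ l) x < (g ^^ Suc l) x" using ascent l by blast
  have B: "{(g ^^ l) x..z} \<subseteq> (g ^^ (l - Suc k)) ` {(g ^^ Suc k) x..z}"
    using k in_I iter_z iter_x[of "l - Suc k" "Suc k"] kl
    by (intro covers) (auto simp del: funpow.simps)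
  show False
  proof (cases "(g ^^ Suc l) x \<le> (g ^^ Suc k) x")
    case True
    \<comment> \<open>Here the middle point is x_(l+1): the interval from x_l to x_(l+1) is
      stretched to \<open>z\<close>, and its image then follows the covering
      \<open>B\<close>.\<close>
    have A: "{(g ^^ Suc l) x..z} \<subseteq> (g ^^ 1) ` {(g ^^ l) x..(g ^^ Suc l) x}"
      using l asc in_I by (intro covers) auto
    have B': "{(g ^^ l) x..z} \<subseteq> (g ^^ (l - Suc k)) ` {(g ^^ Suc l) x..z}"
      by (rule order_trans[OF B]) (use True in auto)
    show False
      using no_horseshoe[OF _ asc _ _ _ _ funpow_covers_trans[OF A B'] B'] l in_I kl by auto
  next
    case False
    have "(g ^^ l) x \<noteq> (g ^^ Suc k) x" using k l by auto
    with le have less: "(g ^^ l) x < (g ^^ Suc k) x" by simp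
    \<comment> \<open>Here the middle point is x_(k+1): the interval from x_l to x_(k+1) reaches the
      other side of \<open>z\<close> and is brought back over \<open>[x_l, z]\<close> by following
      x_(k+2) to x_l.\<close>
    have A: "{z..(g ^^ Suc (Suc k)) x} \<subseteq> (g ^^ 1) ` {(g ^^ l) x..(g ^^ Suc k) x}"
      using l le in_I in_I(1,2)[of l] in_I(1,2)[of "Suc k"] by (intro covers) auto
    have "l - Suc (Suc k) + Suc (Suc k) = l" using kl by simp
    then have l_eq: "(g ^^ (l - Suc (Suc k))) ((g ^^ Suc (Suc k)) x) = (g ^^ l) x"
      by (simp only: iter_x)
    have C: "{(g ^^ l) x..z} \<subseteq> (g ^^ (l - Suc (Suc k))) ` {z..(g ^^ Suc (Suc k)) x}"
      using k in_I by (intro covers) (simp_all only: l_eq iter_z, auto)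
    show False
      using no_horseshoe[OF _ less _ _ _ _ funpow_covers_trans[OF A C] B] k in_I kl by auto
  qed
qed

text \<open>Only an upper bound is needed. Points slightly below \<open>z\<close> have images near
  \<open>z\<close> by continuity, and points above \<open>z\<close> move down. So once the orbit is
  below \<open>z + e\<close> at a late time, it stays there.\<close>

lemma tendsto_if_liminf_ge:
  assumes "\<And>e. e > 0 \<Longrightarrow> \<exists>N. \<forall>n\<ge>N. z - e < (g ^^ n) x"
    and inf_asc: "\<exists>\<^sub>\<infinity>n. (g ^^ n) x < z"
  shows "(\<lambda>n. (g ^^ n) x) \<longlonglongrightarrow> z"
proof (rule LIMSEQ_I)
  fix e :: real assume "e > 0"
  then obtain d where d: "d > 0" "\<And>t. t \<in> {a..b} \<Longrightarrow> dist t z < d \<Longrightarrow> dist (g t) (g z) < e"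
    using cont z unfolding continuous_on_iff by blast
  obtain N where N: "\<And>n. n \<ge> N \<Longrightarrow> z - min d e < (g ^^ n) x"
    using assms(1)[of "min d e"] d \<open>e > 0\<close> by auto
  obtain n0 where n0: "n0 \<ge> N" "(g ^^ n0) x < z"
    using inf_asc unfolding INFM_nat_le by blast
  have "(g ^^ n) x < z + e" if "n \<ge> n0" for n
    using that
  proof (induction n rule: dec_induct)
    case base
    then show ?case using n0 \<open>e > 0\<close> by simp
  next
    case (step n)
    show ?case
    proof (cases "(g ^^ n) x < z")
      case True
      then have "dist ((g ^^ n) x) z < d" using N[of n] step n0 by (simp add: dist_real_def)
      then show ?thesis
        using d(2)[of "(g ^^ n) x"] in_I z by (auto simp: dist_real_def)
    next
      case False
      then show ?thesis using descent[of n] neq[of n] step by force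
    qed
  qed
  then have "norm ((g ^^ n) x - z) < e" if "n \<ge> n0" for n
    using N[of n] n0 that by (auto simp: abs_less_iff) (smt (verit))+
  then show "\<exists>no. \<forall>n\<ge>no. norm ((g ^^ n) x - z) < e" by blast
qed

text \<open>Along the last double ascents the values \<open>u j\<close> interlace as
  \<open>u j < g (u j) < u (Suc j)\<close>, so their limit \<open>L\<close> is a fixed point. Since
  \<open>g (g (u j))\<close> lies above \<open>z\<close> and also tends to \<open>L\<close>,
  \<open>L = z\<close>. By \<open>no_return_below_double_ascent\<close> the whole orbit is then
  eventually above \<open>z - e\<close>.\<close>

lemma tendsto_if_infinitely_many_double_ascents:
  assumes inf: "\<exists>\<^sub>\<infinity>n. (g ^^ n) x < z \<and> (g ^^ Suc n) x < z"
    and inf_desc: "\<exists>\<^sub>\<infinity>n. z < (g ^^ n) x"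
  shows "(\<lambda>n. (g ^^ n) x) \<longlonglongrightarrow> z"
proof -
  let ?S = "{k. last_double_ascent k}"
  have "\<exists>k>N. last_double_ascent k" for N
  proof -
    obtain n where n: "n > N" "(g ^^ n) x < z" "(g ^^ Suc n) x < z"
      using inf unfolding INFM_nat by blast
    obtain m0 where m0: "m0 > n" "z < (g ^^ m0) x"
      using inf_desc unfolding INFM_nat by blast
    \<comment> \<open>The first passage above \<open>z\<close> after a double ascent; the two times
      preceding it form a last double ascent.\<close>
    define m where "m = (LEAST m. m > n \<and> z < (g ^^ m) x)"
    have m: "m > n \<and> z < (g ^^ m) x" unfolding m_def using m0 by (intro LeastI) auto
    have below: "(g ^^ j) x < z" if "n \<le> j" "j < m" for j
    proof (cases "j = n")
      case False
      then show ?thesis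
        using not_less_Least[of j "\<lambda>m. m > n \<and> z < (g ^^ m) x"] that neq[of j]
        unfolding m_def by auto
    qed (use n in auto)
    have "m \<noteq> Suc n" using n m by auto
    then obtain k where k: "m = Suc (Suc k)" "k \<ge> n"
      using m by (cases m; cases "m - 1") auto
    then have "last_double_ascent k"
      unfolding last_double_ascent_def using below[of k] below[of "Suc k"] m by auto
    then show ?thesis using k n by (intro exI[of _ k]) auto
  qed
  then have "infinite ?S" unfolding infinite_nat_iff_unbounded by auto
  define s where "s = enumerate ?S"
  have s: "last_double_ascent (s j)" for j
    using enumerate_in_set[OF \<open>infinite ?S\<close>, of j] by (simp add: s_def)
  have s_less: "s j < s (Suc j)" for j
    unfolding s_def using \<open>infinite ?S\<close> by (rule enumerate_step)
  define u where "u j = (g ^^ s j) x" for j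
  have gu: "g (u j) = (g ^^ Suc (s j)) x" for j by (simp add: u_def)
  have u1: "u j < g (u j)" for j
    unfolding gu unfolding u_def using ascent[of "s j"] s[of j] by (simp add: last_double_ascent_def)
  have u2: "g (u j) < u (Suc j)" for j
    unfolding gu unfolding u_def using double_ascents_increase[OF s s s_less] .
  have uz: "u j < z" for j using s[of j] by (simp add: u_def last_double_ascent_def)
  have "incseq u" by (intro incseq_SucI less_imp_le less_trans[OF u1 u2])
  moreover have "bdd_above (range u)" by (intro bdd_aboveI2[of _ _ z] less_imp_le uz)
  ultimately obtain L where L: "u \<longlonglongrightarrow> L"
    using LIMSEQ_incseq_SUP by blast
  have uI: "u j \<in> {a..b}" for j unfolding u_def using iterate_in[OF x] .
  have guI: "g (u j) \<in> {a..b}" for j unfolding gu using iterate_in[OF x] .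
  have LI: "L \<in> {a..b}"
    by (rule closed_sequentially[OF closed_atLeastAtMost uI L])
  have "(\<lambda>j. g (u j)) \<longlonglongrightarrow> L"
    by (rule tendsto_sandwich[OF always_eventually always_eventually L LIMSEQ_Suc[OF L]])
      (simp_all add: u1 u2 less_imp_le)
  moreover have gt: "(\<lambda>j. g (w j)) \<longlonglongrightarrow> g L" if "\<And>j. w j \<in> {a..b}" "w \<longlonglongrightarrow> L" for w
    by (rule continuous_on_tendsto_compose[OF cont that(2) LI]) (use that(1) in auto)
  ultimately have "g L = L" using LIMSEQ_unique gt[OF uI L] by blast
  have "(\<lambda>j. g (g (u j))) \<longlonglongrightarrow> L"
    using gt[OF guI \<open>(\<lambda>j. g (u j)) \<longlonglongrightarrow> L\<close>] \<open>g L = L\<close> by simp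
  moreover have "z \<le> g (g (u j))" for j
    using s[of j] by (simp add: u_def last_double_ascent_def)
  ultimately have "z \<le> L" by (intro LIMSEQ_le_const) auto
  moreover have "L \<le> z" using LIMSEQ_le_const2[OF L] less_imp_le[OF uz] by blast
  ultimately have "u \<longlonglongrightarrow> z" using L by simp
  have "\<exists>N. \<forall>n\<ge>N. z - e < (g ^^ n) x" if e: "e > 0" for e
  proof -
    obtain j where "z - e < u j"
      using order_tendstoD(1)[OF \<open>u \<longlonglongrightarrow> z\<close>, of "z - e"] e
      unfolding eventually_sequentially by auto
    then have "z - e < (g ^^ n) x" if "n \<ge> Suc (s j)" for n
      using no_return_below_double_ascent[OF s[of j], of n] that by (simp add: u_def)
    then show ?thesis by blast
  qed
  moreover have "\<exists>\<^sub>\<infinity>n. (g ^^ n) x < z" using inf by (rule frequently_elim1) auto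
  ultimately show ?thesis by (rule tendsto_if_liminf_ge)
qed

lemma mirror_orbit: "horseshoe_free_orbit (- b) (- a) (\<lambda>t. - g (- t)) (- x) (- z)"
  by (intro horseshoe_free_orbit.intro mirror, unfold_locales, unfold funpow_uminus_conj)
    (use x z ascent descent neq in auto)

lemma tendsto_if_infinitely_many_double_descents:
  assumes inf: "\<exists>\<^sub>\<infinity>n. z < (g ^^ n) x \<and> z < (g ^^ Suc n) x"
    and inf_asc: "\<exists>\<^sub>\<infinity>n. (g ^^ n) x < z"
  shows "(\<lambda>n. (g ^^ n) x) \<longlonglongrightarrow> z"
proof -
  interpret m: horseshoe_free_orbit "- b" "- a" "\<lambda>t. - g (- t)" "- x" "- z"
    by (rule mirror_orbit)
  have "(\<lambda>n. - (g ^^ n) x) \<longlonglongrightarrow> - z"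
    using m.tendsto_if_infinitely_many_double_ascents assms
    unfolding funpow_uminus_conj by simp
  then show ?thesis by (simp add: tendsto_minus_cancel_left)
qed

end

section \<open>Convergence or alternation of orbits\<close>

lemma convergent_if_eventually_monotone:
  fixes y :: "nat \<Rightarrow> real"
  assumes "\<And>n. y n \<in> {a..b}" and "\<And>n. n \<ge> N \<Longrightarrow> y n \<le> y (Suc n)"
  shows "convergent y"
proof -
  have "incseq (\<lambda>n. y (n + N))" using assms(2) by (intro incseq_SucI) simp
  moreover have "bdd_above (range (\<lambda>n. y (n + N)))" using assms(1) by (intro bdd_aboveI2[of _ _ b]) auto
  ultimately have "convergent (\<lambda>n. y (n + N))"
    using LIMSEQ_incseq_SUP unfolding convergent_def by blast
  then show ?thesis using convergent_ignore_initial_segment[of y N] by simp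
qed

text \<open>A divergent orbit has infinitely many ascents and descents. All ascending points lie
  below all descending ones, so a fixed point \<open>z\<close> separates them. Infinitely many
  consecutive visits to one side of \<open>z\<close> would force convergence to \<open>z\<close>;
  hence the orbit eventually changes sides at every step.\<close>

theorem (in horseshoe_free) orbit_dichotomy:
  assumes x: "x \<in> {a..b}"
  defines "y \<equiv> \<lambda>n. (g ^^ n) x"
  shows "convergent y \<or>
    (\<exists>z N. (\<forall>n\<ge>N. if even n then y n \<le> z else z \<le> y n) \<or>
           (\<forall>n\<ge>N. if even n then z \<le> y n else y n \<le> z))"
proof (cases "convergent y")
  case nc: False
  have yI: "y n \<in> {a..b}" for n unfolding y_def using iterate_in[OF x] .
  have ySuc: "y (Suc n) = g (y n)" for n by (simp add: y_def)
  have neq: "y (Suc n) \<noteq> y n" for n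
  proof
    assume eq: "y (Suc n) = y n"
    have "y (m + n) = y n" for m
      by (induction m) (use eq ySuc in auto)
    then have "convergent (\<lambda>m. y (m + n))" by (simp add: convergent_const)
    then show False using nc convergent_ignore_initial_segment by blast
  qed
  have infU: "\<exists>\<^sub>\<infinity>n. y n < y (Suc n)"
  proof (rule ccontr)
    assume "\<not> ?thesis"
    then obtain N where "\<And>n. n \<ge> N \<Longrightarrow> - y n \<le> - y (Suc n)"
      unfolding INFM_nat_le by force
    then have "convergent (\<lambda>n. - y n)"
      using yI by (intro convergent_if_eventually_monotone[of _ "- b" "- a" N]) auto
    then show False using nc convergent_minus_iff by blast
  qed
  have infD: "\<exists>\<^sub>\<infinity>n. y (Suc n) < y n"
  proof (rule ccontr)
    assume "\<not> ?thesis"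
    then obtain N where "\<And>n. n \<ge> N \<Longrightarrow> y n \<le> y (Suc n)"
      unfolding INFM_nat_le by force
    then show False
      using yI nc convergent_if_eventually_monotone[of y a b N] by auto
  qed
  have UD: "y j < y i" if "y (Suc i) < y i" "y j < y (Suc j)" for i j
    using ascents_below_descents[OF x, of i j] that by (simp add: y_def)
  let ?U = "y ` {n. y n < y (Suc n)}" and ?D = "y ` {n. y (Suc n) < y n}"
  have Une: "?U \<noteq> {}" and Dne: "?D \<noteq> {}" using infU infD by (auto dest: frequently_ex)
  have Ub: "bdd_above ?U" and Db: "bdd_below ?D"
    using yI by (auto intro!: bdd_aboveI2[of _ _ b] bdd_belowI2[of _ a])
  have SI: "Sup ?U \<le> Inf ?D"
    using UD by (intro cSup_least[OF Une] cInf_greatest[OF Dne]) (force intro: less_imp_le)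
  \<comment> \<open>The supremum and infimum are limits of orbit points, so the weak inequalities
    between \<open>t\<close> and \<open>g t\<close> pass to them. They give the sign change that
    yields \<open>z\<close>.\<close>
  have UDI: "?U \<subseteq> {a..b}" "?D \<subseteq> {a..b}" using yI by auto
  have Icl: "closure ?U \<subseteq> {a..b}" "closure ?D \<subseteq> {a..b}"
    using closure_minimal[OF UDI(1)] closure_minimal[OF UDI(2)] by auto
  have SU: "Sup ?U \<in> closure ?U" using closure_contains_Sup[OF Une Ub] .
  have ID: "Inf ?D \<in> closure ?D" using closure_contains_Inf[OF Dne Db] .
  have cl: "closed {t \<in> {a..b}. t \<le> g t}" "closed {t \<in> {a..b}. g t \<le> t}"
    by (intro continuous_on_closed_Collect_le cont continuous_on_id closed_atLeastAtMost)+
  have gS: "Sup ?U \<le> g (Sup ?U)"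
  proof -
    have "?U \<subseteq> {t \<in> {a..b}. t \<le> g t}" using yI by (auto simp: ySuc less_imp_le)
    then show ?thesis using closure_minimal[OF _ cl(1)] SU by blast
  qed
  have gI: "g (Inf ?D) \<le> Inf ?D"
  proof -
    have "?D \<subseteq> {t \<in> {a..b}. g t \<le> t}" using yI by (auto simp: ySuc less_imp_le)
    then show ?thesis using closure_minimal[OF _ cl(2)] ID by blast
  qed
  have "Sup ?U \<in> {a..b}" "Inf ?D \<in> {a..b}" using SU ID Icl by blast+
  then have "continuous_on {Sup ?U..Inf ?D} (\<lambda>t. g t - t)"
    by (intro continuous_on_diff continuous_on_subset[OF cont] continuous_on_id) auto
  then obtain z where z: "Sup ?U \<le> z" "z \<le> Inf ?D" "g z - z = 0"
    using IVT2'[of "\<lambda>t. g t - t" "Inf ?D" 0 "Sup ?U"] gS gI SI by auto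
  have yz: "y n \<noteq> z" for n using neq[of n] z ySuc[of n] by auto
  have yU: "y n < z" if "y n < y (Suc n)" for n
    using cSup_upper[OF _ Ub, of "y n"] that z(1) yz[of n] by force
  have yD: "z < y n" if "y (Suc n) < y n" for n
    using cInf_lower[OF _ Db, of "y n"] that z(2) yz[of n] by force
  interpret horseshoe_free_orbit a b g x z
  proof
    show "z \<in> {a..b}" using z \<open>Sup ?U \<in> {a..b}\<close> \<open>Inf ?D \<in> {a..b}\<close> by auto
    show "g z = z" using z by simp
    show "(g ^^ n) x < (g ^^ Suc n) x" if "(g ^^ n) x < z" for n
      using yD[of n] neq[of n] that unfolding y_def by force
    show "(g ^^ Suc n) x < (g ^^ n) x" if "z < (g ^^ n) x" for n
      using yU[of n] neq[of n] that unfolding y_def by force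
    show "(g ^^ n) x \<noteq> z" for n using yz by (simp add: y_def)
  qed (rule x)
  have infU': "\<exists>\<^sub>\<infinity>n. y n < z" using infU by (rule frequently_elim1) (rule yU)
  have infD': "\<exists>\<^sub>\<infinity>n. z < y n" using infD by (rule frequently_elim1) (rule yD)
  have "\<not> (\<exists>\<^sub>\<infinity>n. y n < z \<and> y (Suc n) < z)"
    using tendsto_if_infinitely_many_double_ascents infD' nc
    unfolding y_def convergent_def by blast
  moreover have "\<not> (\<exists>\<^sub>\<infinity>n. z < y n \<and> z < y (Suc n))"
    using tendsto_if_infinitely_many_double_descents infU' nc
    unfolding y_def convergent_def by blast
  ultimately obtain N1 N2 where
    N1: "\<And>n. n \<ge> N1 \<Longrightarrow> \<not> (y n < z \<and> y (Suc n) < z)" and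
    N2: "\<And>n. n \<ge> N2 \<Longrightarrow> \<not> (z < y n \<and> z < y (Suc n))"
    unfolding INFM_nat_le by blast
  \<comment> \<open>The factor 2 makes \<open>N\<close> even, so the side at time \<open>n\<close>
    is determined by the side at \<open>N\<close> and the parity of \<open>n\<close> itself.\<close>
  define N where "N = 2 * max N1 N2"
  have alt: "y (Suc n) < z \<longleftrightarrow> \<not> y n < z" if "n \<ge> N" for n
  proof -
    have "n \<ge> N1" "n \<ge> N2" using that by (auto simp: N_def)
    then show ?thesis using N1[of n] N2[of n] yz[of n] yz[of "Suc n"] by linarith
  qed
  have side: "y n < z \<longleftrightarrow> (y N < z \<longleftrightarrow> even n)" if "n \<ge> N" for n
    using that
  proof (induction n rule: dec_induct)
    case base
    then show ?case by (simp add: N_def)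
  next
    case (step n)
    then show ?case using alt[of n] by auto
  qed
  show ?thesis
  proof (cases "y N < z")
    case True
    have "if even n then y n \<le> z else z \<le> y n" if "n \<ge> N" for n
      using side[OF that] True by auto
    then show ?thesis by blast
  next
    case False
    have "if even n then z \<le> y n else y n \<le> z" if "n \<ge> N" for n
      using side[OF that] False by auto
    then show ?thesis by blast
  qed
qed simp

subsection \<open>Horseshoes and entropy\<close>

text \<open>Constructed backwards: a point following the tail of the word lies in \<open>A\<close>
  or \<open>B\<close>, hence has a preimage in whichever set the first letter prescribes.\<close>

lemma itinerary_exists:
  assumes "A \<union> B \<subseteq> F ` A" "A \<union> B \<subseteq> F ` B" "A \<noteq> {}"
  shows "\<exists>x\<in>A \<union> B. \<forall>i<length w. (F ^^ i) x \<in> (if w ! i then A else B)"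
proof (induction w)
  case Nil
  then show ?case using assms(3) by auto
next
  case (Cons c w)
  then obtain y where y: "y \<in> A \<union> B" "\<And>i. i < length w \<Longrightarrow> (F ^^ i) y \<in> (if w ! i then A else B)"
    by blast
  have "y \<in> F ` (if c then A else B)" using y(1) assms by (auto split: if_splits)
  then obtain x where x: "x \<in> (if c then A else B)" "F x = y" by blast
  have "(F ^^ i) x \<in> (if (c # w) ! i then A else B)" if "i < length (c # w)" for i
    using that x y by (cases i) (auto simp del: funpow.simps simp: funpow_Suc_right)
  then show ?case using x by (intro bexI[of _ x]) (auto split: if_splits)
qed

text \<open>One point is chosen for each of the \<open>2 ^ k\<close> words. Two different words
  differ at some \<open>i < k\<close>, so their points lie on opposite sides of the gap at time
  \<open>M * i\<close>.\<close>

lemma separated_if_covering: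
  fixes f :: "real \<Rightarrow> real"
  assumes "A \<union> B \<subseteq> X" and cov: "A \<union> B \<subseteq> (f ^^ M) ` A" "A \<union> B \<subseteq> (f ^^ M) ` B" "A \<noteq> {}"
    and gap: "\<And>s t. s \<in> A \<Longrightarrow> t \<in> B \<Longrightarrow> \<epsilon> < dist s t" and "M > 0" "\<epsilon> \<ge> 0"
  shows "\<exists>E. finite E \<and> separated X f (M * k) \<epsilon> E \<and> card E = 2 ^ k"
proof -
  have "\<forall>w. \<exists>x\<in>A \<union> B. \<forall>i<length w. ((f ^^ M) ^^ i) x \<in> (if w ! i then A else B)"
    using itinerary_exists[OF cov] by blast
  then obtain p where p: "\<And>w. p w \<in> A \<union> B"
    "\<And>w i. i < length w \<Longrightarrow> (f ^^ (M * i)) (p w) \<in> (if w ! i then A else B)"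
    unfolding funpow_mult by metis
  define W where "W = {w :: bool list. length w = k}"
  have gap': "\<epsilon> < dist t s" if "s \<in> A" "t \<in> B" for s t
    using gap[OF that] by (simp add: dist_commute)
  have sep: "\<exists>j<M * k. \<epsilon> < dist ((f ^^ j) (p v)) ((f ^^ j) (p w))"
    if vw: "v \<in> W" "w \<in> W" "v \<noteq> w" for v w
  proof -
    obtain i where i: "i < k" "v ! i \<noteq> w ! i"
      using vw by (auto simp: W_def list_eq_iff_nth_eq)
    then have "\<epsilon> < dist ((f ^^ (M * i)) (p v)) ((f ^^ (M * i)) (p w))"
      using p(2)[of i v] p(2)[of i w] vw gap gap' by (auto simp: W_def split: if_splits)
    then show ?thesis using i \<open>M > 0\<close> by (intro exI[of _ "M * i"]) auto
  qed
  show ?thesis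
  proof (intro exI conjI)
    have "inj_on p W" using sep \<open>\<epsilon> \<ge> 0\<close> by (fastforce intro: inj_onI)
    moreover have "finite W" "card W = 2 ^ k"
      using finite_lists_length_eq[of "UNIV :: bool set" k] card_lists_length_eq[of "UNIV :: bool set" k]
      by (auto simp: W_def)
    ultimately show "finite (p ` W)" "card (p ` W) = 2 ^ k" by (auto simp: card_image)
    show "separated X f (M * k) \<epsilon> (p ` W)"
      unfolding separated_def using p(1) assms(1) sep by blast
  qed
qed

text \<open>Along the times \<open>M * Suc k\<close> the separated sets of size
  \<open>2 ^ Suc k\<close> give the constant growth rate \<open>ln 2 / M\<close>, and a subsequence
  bounds the limsup from below. \<open>Suc\<close> avoids time 0, where the quotient is 0 by
  convention.\<close>

lemma entropy_pos_if_covering: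
  fixes f :: "real \<Rightarrow> real"
  assumes "A \<union> B \<subseteq> X" and cov: "A \<union> B \<subseteq> (f ^^ M) ` A" "A \<union> B \<subseteq> (f ^^ M) ` B" "A \<noteq> {}"
    and gap: "\<And>s t. s \<in> A \<Longrightarrow> t \<in> B \<Longrightarrow> \<epsilon> < dist s t" and "M > 0" and "\<epsilon> > 0"
  shows "topological_entropy X f > 0"
proof -
  let ?h = "\<lambda>\<epsilon> n. SUP E\<in>{E. finite E \<and> separated X f n \<epsilon> E}. ereal (ln (real (card E)) / real n)"
  have le: "ereal (ln 2 / real M) \<le> ?h \<epsilon> (M * Suc k)" for k
  proof -
    obtain E where E: "finite E" "separated X f (M * Suc k) \<epsilon> E" "card E = 2 ^ Suc k"
      using separated_if_covering[OF assms(1) cov gap \<open>M > 0\<close> less_imp_le[OF \<open>\<epsilon> > 0\<close>]] by blast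
    have "ln 2 / real M = ln (real (card E)) / real (M * Suc k)"
      using \<open>M > 0\<close> unfolding E(3) of_nat_power ln_realpow of_nat_mult
      by (simp add: ln_realpow del: power_Suc of_nat_Suc)
    then show ?thesis
      using E by (intro SUP_upper2[of E]) auto
  qed
  have "0 < ereal (ln 2 / real M)" using \<open>M > 0\<close> by simp
  also have "\<dots> \<le> limsup (?h \<epsilon>)"
  proof -
    have "strict_mono (\<lambda>k. M * Suc k)" using \<open>M > 0\<close> by (intro strict_monoI) auto
    then have "limsup (?h \<epsilon> \<circ> (\<lambda>k. M * Suc k)) \<le> limsup (?h \<epsilon>)" by (rule limsup_subseq_mono)
    moreover have "ereal (ln 2 / real M) \<le> limsup (?h \<epsilon> \<circ> (\<lambda>k. M * Suc k))"
      using le by (intro le_Limsup) (auto intro!: always_eventually)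
    ultimately show ?thesis by (rule order_trans[rotated])
  qed
  also have "\<dots> \<le> topological_entropy X f"
    unfolding topological_entropy_def using \<open>\<epsilon> > 0\<close> by (intro SUP_upper) auto
  finally show ?thesis .
qed

text \<open>Used to give both halves of a horseshoe the common time \<open>m * n\<close>.\<close>

lemma covers_iterate:
  assumes "S \<subseteq> (f ^^ m) ` T" "T \<subseteq> S" "n > 0"
  shows "S \<subseteq> (f ^^ (m * n)) ` T"
  using \<open>n > 0\<close>
proof (induction n rule: nat_induct_non_zero)
  case 1
  then show ?case using assms by simp
next
  case (Suc n)
  have "S \<subseteq> (f ^^ m) ` T" by fact
  also have "\<dots> \<subseteq> (f ^^ m) ` (f ^^ (m * n)) ` T"
    using Suc assms(2) by (intro image_mono) blast
  finally show ?case by (simp add: funpow_add image_comp)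
qed

text \<open>The two halves \<open>[p, q]\<close> and \<open>[q, r]\<close> share an endpoint. Two steps suffice to separate them:
  the part of \<open>[p, q]\<close> mapped to one of the halves can be chosen away from \<open>q\<close>.\<close>

lemma entropy_pos_if_horseshoe:
  fixes f :: "real \<Rightarrow> real"
  assumes cont: "continuous_on {a..b} f" and maps: "f \<in> {a..b} \<rightarrow> {a..b}"
    and "a \<le> p" "p < q" "q < r" "r \<le> b" "0 < m" "0 < n"
    and pq: "{p..r} \<subseteq> (f ^^ m) ` {p..q}" and qr: "{p..r} \<subseteq> (f ^^ n) ` {q..r}"
  shows "topological_entropy {a..b} f > 0"
proof -
  define M where "M = m * n"
  have "M > 0" using assms by (simp add: M_def)
  have pq: "{p..r} \<subseteq> (f ^^ M) ` {p..q}"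
    unfolding M_def using assms by (intro covers_iterate[OF pq]) auto
  have qr: "{p..r} \<subseteq> (f ^^ M) ` {q..r}"
    unfolding M_def mult.commute[of m] using assms by (intro covers_iterate[OF qr]) auto
  define h where "h = f ^^ M"
  have h: "continuous_on {p..q} h"
    unfolding h_def
    by (rule continuous_on_subset[OF continuous_on_funpow[OF cont maps]]) (use assms in auto)
  \<comment> \<open>Between preimages \<open>u\<close> of \<open>p\<close> and \<open>v\<close> of
    \<open>r\<close> lies a preimage of \<open>q\<close>. The part to its left ends strictly before
    \<open>q\<close> and covers \<open>[p, q]\<close> or \<open>[q, r]\<close>, according to the
    order of \<open>u\<close> and \<open>v\<close>.\<close>
  obtain s t where st: "p \<le> s" "s \<le> t" "t < q" "{p..q} \<subseteq> h ` {s..t} \<or> {q..r} \<subseteq> h ` {s..t}"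
  proof -
    have "p \<in> h ` {p..q}" "r \<in> h ` {p..q}"
      using pq assms unfolding h_def by force+
    then obtain u v where uv: "u \<in> {p..q}" "v \<in> {p..q}" "h u = p" "h v = r" by auto
    have sub: "continuous_on {u..v} h" "continuous_on {v..u} h"
      using uv by (auto intro!: continuous_on_subset[OF h])
    show thesis
    proof (cases "u \<le> v")
      case True
      then obtain t where t: "u \<le> t" "t \<le> v" "h t = q"
        using IVT'[of h u q v] uv sub assms by auto
      have "t \<noteq> v" using t uv assms by auto
      moreover have "{p..q} \<subseteq> h ` {u..t}"
      proof
        fix y assume "y \<in> {p..q}"
        then obtain w where "u \<le> w" "w \<le> t" "h w = y"
          using IVT'[of h u y t] uv t continuous_on_subset[OF sub(1)] by auto
        then show "y \<in> h ` {u..t}" by auto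
      qed
      ultimately show thesis using that[of u t] uv t by auto
    next
      case False
      then obtain t where t: "v \<le> t" "t \<le> u" "h t = q"
        using IVT2'[of h u q v] uv sub assms by auto
      have "t \<noteq> u" using t uv assms by auto
      moreover have "{q..r} \<subseteq> h ` {v..t}"
      proof
        fix y assume "y \<in> {q..r}"
        then obtain w where "v \<le> w" "w \<le> t" "h w = y"
          using IVT2'[of h t y v] uv t continuous_on_subset[OF sub(2)] by auto
        then show "y \<in> h ` {v..t}" by auto
      qed
      ultimately show thesis using that[of v t] uv t by auto
    qed
  qed
  have h2: "f ^^ (2 * M) = h \<circ> h" by (simp add: h_def mult_2 funpow_add)
  have A: "{p..r} \<subseteq> (h \<circ> h) ` {s..t}"
    using st(4)
  proof
    assume "{p..q} \<subseteq> h ` {s..t}"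
    then have "h ` {p..q} \<subseteq> h ` h ` {s..t}" by (rule image_mono)
    then show ?thesis using pq by (simp add: h_def image_comp)
  next
    assume "{q..r} \<subseteq> h ` {s..t}"
    then have "h ` {q..r} \<subseteq> h ` h ` {s..t}" by (rule image_mono)
    then show ?thesis using qr by (simp add: h_def image_comp)
  qed
  have B: "{p..r} \<subseteq> (h \<circ> h) ` {q..r}"
    using covers_iterate[OF qr, of 2] assms by (simp add: h2[symmetric] mult.commute)
  have sub: "{s..t} \<union> {q..r} \<subseteq> {p..r}" using st assms by auto
  show ?thesis
  proof (rule entropy_pos_if_covering[where A = "{s..t}" and B = "{q..r}" and M = "2 * M"
        and \<epsilon> = "(q - t) / 2"])
    show "{s..t} \<union> {q..r} \<subseteq> {a..b}" using sub assms by auto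
    show "{s..t} \<union> {q..r} \<subseteq> (f ^^ (2 * M)) ` {s..t}" unfolding h2 using sub A by blast
    show "{s..t} \<union> {q..r} \<subseteq> (f ^^ (2 * M)) ` {q..r}" unfolding h2 using sub B by blast
    \<comment> \<open>Half the gap, because separation asks for a strict inequality.\<close>
    show "(q - t) / 2 < dist u v" if "u \<in> {s..t}" "v \<in> {q..r}" for u v
      using that st by (auto simp: dist_real_def)
  qed (use st \<open>M > 0\<close> in auto)
qed

subsection \<open>Averages along oscillating sequences\<close>

text \<open>A geometric sum whose ratio is an \<open>M\<close>-th root of unity, equal to 1 exactly
  when \<open>n\<close> has residue \<open>r\<close>.\<close>

lemma sum_unity_roots_eq_indicator:
  fixes n r M :: nat
  assumes "r < M"
  shows "(\<Sum>j<M. exp (2 * of_real pi * \<i> * of_nat n * of_real (real j / real M)) *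
      exp (- (2 * of_real pi * \<i> * of_nat r * of_real (real j / real M)))) =
    (if n mod M = r then of_nat M else 0 :: complex)"
proof -
  define w :: complex where
    "w = exp (2 * of_real pi * \<i> * of_nat n / of_nat M) / exp (2 * of_real pi * \<i> * of_nat r / of_nat M)"
  have "M \<noteq> 0" using assms by simp
  have "exp (2 * of_real pi * \<i> * of_nat n * of_real (real j / real M)) *
      exp (- (2 * of_real pi * \<i> * of_nat r * of_real (real j / real M))) = w ^ j" for j
    unfolding w_def power_divide exp_of_nat_mult[symmetric] exp_minus exp_diff[symmetric]
      exp_add[symmetric] by (simp add: exp_minus[symmetric] exp_add[symmetric] exp_diff[symmetric] algebra_simps)
  then have "(\<Sum>j<M. exp (2 * of_real pi * \<i> * of_nat n * of_real (real j / real M)) *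
      exp (- (2 * of_real pi * \<i> * of_nat r * of_real (real j / real M)))) = (\<Sum>j<M. w ^ j)"
    by simp
  also have "\<dots> = (if n mod M = r then of_nat M else 0)"
  proof -
    have "exp (2 * of_real pi * \<i> * of_nat n / of_nat M) ^ M = (1::complex)" for n :: nat
      using complex_root_unity[OF \<open>M \<noteq> 0\<close>, of n] by simp
    then have "w ^ M = 1" by (simp add: w_def power_divide)
    moreover have "w = 1 \<longleftrightarrow> n mod M = r"
      using complex_root_unity_eq[of M n r] \<open>M \<noteq> 0\<close> assms by (simp add: w_def cong_def)
    ultimately show ?thesis by (auto simp: sum_gp_strict)
  qed
  finally show ?thesis .
qed

text \<open>Finite Fourier expansion: a function of \<open>n mod M\<close> is a combination of
  exponentials with frequencies \<open>j / M\<close> in \<open>[0, 1)\<close>, to which the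
  oscillation hypothesis applies.\<close>

lemma oscillating_averages_periodic:
  assumes "oscillating c" and "M > 0"
  shows "(\<lambda>N. (\<Sum>n=1..N. c n * p (n mod M)) / of_nat N) \<longlonglongrightarrow> 0"
proof -
  define e :: "nat \<Rightarrow> nat \<Rightarrow> complex" where
    "e n j = exp (2 * of_real pi * \<i> * of_nat n * of_real (real j / real M))" for n j
  define e' :: "nat \<Rightarrow> nat \<Rightarrow> complex" where
    "e' n j = exp (- (2 * of_real pi * \<i> * of_nat n * of_real (real j / real M)))" for n j
  have lim: "(\<lambda>N. (\<Sum>n=1..N. c n * e n j) / of_nat N) \<longlonglongrightarrow> 0" if "j < M" for j
  proof -
    have "real j / real M \<in> {0..<1}" using that by simp
    then show ?thesis using assms(1) unfolding oscillating_def e_def by blast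
  qed
  have ind: "(\<Sum>j<M. e n j * e' r j) = (if n mod M = r then of_nat M else 0)" if "r < M" for n r
    using sum_unity_roots_eq_indicator[OF that, of n] unfolding e_def e'_def .
  have p_eq: "p (n mod M) = (\<Sum>r<M. \<Sum>j<M. e n j * (p r * e' r j / of_nat M))" for n
  proof -
    have "(\<Sum>r<M. \<Sum>j<M. e n j * (p r * e' r j / of_nat M)) =
        (\<Sum>r<M. p r / of_nat M * (\<Sum>j<M. e n j * e' r j))"
      by (simp add: sum_distrib_left mult_ac)
    also have "\<dots> = (\<Sum>r<M. if n mod M = r then p r else 0)"
      using assms(2) by (intro sum.cong refl) (simp add: ind)
    also have "\<dots> = p (n mod M)" using assms(2) by (simp add: sum.delta')
    finally show ?thesis by simp
  qed
  have eq: "(\<Sum>n=1..N. c n * p (n mod M)) / of_nat N =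
      (\<Sum>r<M. \<Sum>j<M. (\<Sum>n=1..N. c n * e n j) / of_nat N * (p r * e' r j / of_nat M))" for N
  proof -
    have "(\<Sum>n=1..N. c n * p (n mod M)) =
        (\<Sum>n=1..N. \<Sum>r<M. \<Sum>j<M. c n * e n j * (p r * e' r j / of_nat M))"
      unfolding p_eq by (simp add: sum_distrib_left mult_ac)
    also have "\<dots> = (\<Sum>r<M. \<Sum>n=1..N. \<Sum>j<M. c n * e n j * (p r * e' r j / of_nat M))"
      by (rule sum.swap)
    also have "\<dots> = (\<Sum>r<M. \<Sum>j<M. \<Sum>n=1..N. c n * e n j * (p r * e' r j / of_nat M))"
      by (intro sum.cong refl sum.swap)
    finally show ?thesis
      by (simp only: sum_distrib_right[symmetric] sum_divide_distrib[of _ "{..<M}"] times_divide_eq_left)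
  qed
  show ?thesis
    unfolding eq using lim by (intro tendsto_null_sum tendsto_mult_left_zero) auto
qed

section \<open>Averages along almost periodic sequences\<close>

lemma card_residues_le:
  assumes "M > 0" "finite R"
  shows "real (card {n \<in> {1..N}. n mod M \<in> R}) \<le> real (card R) * (real N / real M + 1)"
proof -
  have "n div M * M + n mod M = n" for n :: nat by simp
  then have "inj_on (\<lambda>n. (n mod M, n div M)) {n \<in> {1..N}. n mod M \<in> R}"
    by (intro inj_onI) (metis prod.inject)
  moreover have "(\<lambda>n. (n mod M, n div M)) ` {n \<in> {1..N}. n mod M \<in> R} \<subseteq> R \<times> {..N div M}"
    by (auto intro: div_le_mono)
  ultimately have "card {n \<in> {1..N}. n mod M \<in> R} \<le> card (R \<times> {..N div M})"
    using assms by (intro card_inj_on_le) auto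
  then have "real (card {n \<in> {1..N}. n mod M \<in> R}) \<le> real (card R * Suc (N div M))"
    unfolding card_cartesian_product card_atMost of_nat_le_iff .
  also have "\<dots> \<le> real (card R) * (real N / real M + 1)"
    unfolding of_nat_mult of_nat_Suc
    using of_nat_div_le_of_nat[of N M] by (intro mult_left_mono) auto
  finally show ?thesis .
qed

text \<open>Truncation at height \<open>K\<close> replaces Hoelder's inequality.\<close>

lemma le_truncation:
  fixes t K l :: real
  assumes "t \<ge> 0" "K > 0" "l > 1"
  shows "t \<le> K + K powr (1 - l) * t powr l"
proof (cases "t \<le> K")
  case False
  then have "t > 0" using assms by simp
  have "t = t powr (1 - l) * t powr l"
    using \<open>t > 0\<close> by (simp add: powr_add[symmetric])
  also have "\<dots> \<le> K powr (1 - l) * t powr l"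
    using False assms by (intro mult_right_mono powr_mono2') auto
  finally show ?thesis using assms by simp
qed (use assms in \<open>simp add: add_increasing2\<close>)

text \<open>The periodic approximant contributes averages tending to 0. The error is split into
  finitely many early times, the residues in \<open>R\<close>, which have density at most
  \<open>\<epsilon>\<close>, and the remaining times, where the approximation is good. The moment
  bound controls the weights in the last two.\<close>

lemma oscillating_averages_almost_periodic:
  fixes y :: "nat \<Rightarrow> complex"
  assumes osc: "oscillating c" and yB: "\<And>n. cmod (y n) \<le> B"
    and approx: "\<And>\<epsilon>. \<epsilon> > 0 \<Longrightarrow> \<exists>M p R N0. M > 0 \<and> R \<subseteq> {..<M} \<and> real (card R) \<le> \<epsilon> * real M \<and>
      (\<forall>r. cmod (p r) \<le> B) \<and> (\<forall>n\<ge>N0. n mod M \<notin> R \<longrightarrow> cmod (y n - p (n mod M)) \<le> \<epsilon>)"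
  shows "(\<lambda>N. (\<Sum>n=1..N. c n * y n) / of_nat N) \<longlonglongrightarrow> 0"
proof -
  obtain l where l: "l > 1" "convergent (\<lambda>N. (\<Sum>n=1..N. cmod (c n) powr l) / real N)"
    using osc unfolding oscillating_def by blast
  then have "Bseq (\<lambda>N. (\<Sum>n=1..N. cmod (c n) powr l) / real N)"
    using Bseq_conv_Bfun convergent_imp_Bseq by blast
  then obtain C where C: "C > 0" "\<And>N. norm ((\<Sum>n=1..N. cmod (c n) powr l) / real N) \<le> C"
    unfolding Bseq_def by blast
  have CN: "(\<Sum>n=1..N. cmod (c n) powr l) \<le> C * real N" for N
    using C(2)[of N] by (cases "N = 0") (auto simp: field_simps)
  have "B \<ge> 0" using yB[of 0] norm_ge_zero order_trans by blast
  have bound: "\<exists>N1. \<forall>N\<ge>N1. cmod ((\<Sum>n=1..N. c n * y n) / of_nat N) < e" if "e > 0" for e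
  proof -
    \<comment> \<open>The truncation height is fixed first, from the moment bound alone;
      \<open>l > 1\<close> makes the part of the weights above it negligible. Only then is
      \<open>\<epsilon>\<close> chosen, depending on \<open>K\<close>.\<close>
    have "((\<lambda>K. 2 * B * (K powr (1 - l) * C)) \<longlongrightarrow> 2 * B * (0 * C)) at_top"
      using l by (intro tendsto_intros tendsto_neg_powr filterlim_ident) auto
    then have "\<forall>\<^sub>F K in at_top. 2 * B * (K powr (1 - l) * C) < e / 8"
      using that by (intro order_tendstoD) auto
    then have "\<forall>\<^sub>F K in at_top. 2 * B * (K powr (1 - l) * C) < e / 8 \<and> K > 0"
      using eventually_gt_at_top[of 0] by eventually_elim auto
    then obtain K where K: "2 * B * (K powr (1 - l) * C) < e / 8" "K > 0"
      using eventually_happens' trivial_limit_at_top_linorder by blast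
    define \<epsilon> where "\<epsilon> = e / (8 * (1 + C + 2 * B * K))"
    have den: "1 + C + 2 * B * K > 0" using C K \<open>B \<ge> 0\<close> by (auto intro!: add_pos_nonneg)
    then have "\<epsilon> > 0" using that by (simp add: \<epsilon>_def)
    have \<epsilon>_le: "\<epsilon> * (1 + C) + 2 * B * K * \<epsilon> = e / 8"
    proof -
      have "e / (8 * D) * D = e / 8" if "D > 0" for D using that by simp
      then have "\<epsilon> * (1 + C + 2 * B * K) = e / 8" unfolding \<epsilon>_def using den by blast
      then show ?thesis by (simp add: algebra_simps)
    qed
    obtain M p R N0 where M: "M > 0" "R \<subseteq> {..<M}" "real (card R) \<le> \<epsilon> * real M"
      and p: "\<And>r. cmod (p r) \<le> B"
      and N0: "\<And>n. n \<ge> N0 \<Longrightarrow> n mod M \<notin> R \<Longrightarrow> cmod (y n - p (n mod M)) \<le> \<epsilon>"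
      using approx[OF \<open>\<epsilon> > 0\<close>] by blast
    have "finite R" using M finite_subset by blast
    define d where "d n = cmod (y n - p (n mod M))" for n
    have d2B: "d n \<le> 2 * B" for n
      unfolding d_def using norm_triangle_ineq4[of "y n" "p (n mod M)"] yB[of n] p[of "n mod M"] by linarith
    define I where "I = (\<Sum>n<N0. cmod (c n) * (2 * B))"
    \<comment> \<open>The three summands cover the good times, with truncation at height 1, the
      times before \<open>N0\<close>, and the residues in \<open>R\<close>, with truncation at
      height \<open>K\<close>.\<close>
    have bound_term: "cmod (c n) * d n \<le> \<epsilon> * (1 + cmod (c n) powr l) +
        (if n < N0 then cmod (c n) * (2 * B) else 0) +
        2 * B * ((if n mod M \<in> R then K else 0) + K powr (1 - l) * cmod (c n) powr l)" for n
    proof -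
      have c1: "cmod (c n) \<le> 1 + cmod (c n) powr l"
        using le_truncation[of "cmod (c n)" 1 l] l by simp
      have cK: "cmod (c n) \<le> K + K powr (1 - l) * cmod (c n) powr l"
        using le_truncation[of "cmod (c n)" K l] l K by simp
      have nn: "0 \<le> \<epsilon> * (1 + cmod (c n) powr l)" "0 \<le> K powr (1 - l) * cmod (c n) powr l"
        "0 \<le> cmod (c n) * (2 * B)" "0 \<le> 2 * B * (K powr (1 - l) * cmod (c n) powr l)"
        "0 \<le> 2 * B * K"
        using \<open>\<epsilon> > 0\<close> \<open>B \<ge> 0\<close> K by (auto intro!: mult_nonneg_nonneg)
      consider "n < N0" | "n \<ge> N0" "n mod M \<in> R" | "n \<ge> N0" "n mod M \<notin> R" by linarith
      then show ?thesis
      proof cases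
        case 1
        have "cmod (c n) * d n \<le> cmod (c n) * (2 * B)" using d2B by (intro mult_left_mono) auto
        then show ?thesis using 1 nn by (auto simp: distrib_left)
      next
        case 2
        have "cmod (c n) * d n \<le> (K + K powr (1 - l) * cmod (c n) powr l) * (2 * B)"
          using d2B cK \<open>B \<ge> 0\<close> nn K by (intro mult_mono) (auto simp: d_def)
        then show ?thesis using 2 nn by (auto simp: mult.commute)
      next
        case 3
        have "cmod (c n) * d n \<le> (1 + cmod (c n) powr l) * \<epsilon>"
          using c1 N0[OF 3] \<open>\<epsilon> > 0\<close> by (intro mult_mono) (auto simp: d_def)
        then show ?thesis using 3 nn by (auto simp: mult.commute)
      qed
    qed
    have dsum: "(\<Sum>n=1..N. cmod (c n) * d n) \<le>
        real N * (e / 4) + (I + 2 * B * K * real (card R))" for N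
    proof -
      have "(\<Sum>n=1..N. cmod (c n) * d n) \<le> (\<Sum>n=1..N. \<epsilon> * (1 + cmod (c n) powr l) +
        (if n < N0 then cmod (c n) * (2 * B) else 0) +
        2 * B * ((if n mod M \<in> R then K else 0) + K powr (1 - l) * cmod (c n) powr l))"
        using bound_term by (intro sum_mono)
      also have "\<dots> = \<epsilon> * (real N + (\<Sum>n=1..N. cmod (c n) powr l)) +
          (\<Sum>n=1..N. if n < N0 then cmod (c n) * (2 * B) else 0) +
          2 * B * ((\<Sum>n=1..N. if n mod M \<in> R then K else 0) + K powr (1 - l) * (\<Sum>n=1..N. cmod (c n) powr l))"
        by (simp add: sum.distrib sum_distrib_left[symmetric])
      also have "\<dots> \<le> \<epsilon> * (real N + C * real N) + I +
          2 * B * (K * (\<epsilon> * real N + real (card R)) + K powr (1 - l) * (C * real N))"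
      proof -
        have "(\<Sum>n=1..N. if n < N0 then cmod (c n) * (2 * B) else 0) =
            (\<Sum>n\<in>{1..N} \<inter> {..<N0}. cmod (c n) * (2 * B))"
          by (subst sum.inter_restrict) (auto intro!: sum.cong)
        also have "\<dots> \<le> I"
          unfolding I_def using \<open>B \<ge> 0\<close> by (intro sum_mono2) auto
        finally have 1: "(\<Sum>n=1..N. if n < N0 then cmod (c n) * (2 * B) else 0) \<le> I" .
        have "(\<Sum>n=1..N. if n mod M \<in> R then K else 0) = K * real (card {n \<in> {1..N}. n mod M \<in> R})"
          by (subst sum.inter_filter[symmetric]) auto
        also have "\<dots> \<le> K * (real (card R) * (real N / real M + 1))"
          using K card_residues_le[OF \<open>M > 0\<close> \<open>finite R\<close>] by (intro mult_left_mono) auto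
        also have "\<dots> \<le> K * (\<epsilon> * real N + real (card R))"
        proof -
          have "real (card R) * (real N / real M) \<le> \<epsilon> * real M * (real N / real M)"
            using M by (intro mult_right_mono) auto
          also have "\<dots> = \<epsilon> * real N" using M by simp
          finally show ?thesis using K by (intro mult_left_mono) (auto simp: algebra_simps)
        qed
        finally have 2: "(\<Sum>n=1..N. if n mod M \<in> R then K else 0) \<le> K * (\<epsilon> * real N + real (card R))" .
        show ?thesis
          using 1 2 CN[of N] \<open>\<epsilon> > 0\<close> \<open>B \<ge> 0\<close>
          by (intro add_mono mult_left_mono) auto
      qed
      also have "\<dots> = real N * (\<epsilon> * (1 + C) + 2 * B * K * \<epsilon> + 2 * B * (K powr (1 - l) * C)) +
          (I + 2 * B * K * real (card R))"
        by (simp add: algebra_simps)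
      also have "\<dots> \<le> real N * (e / 4) + (I + 2 * B * K * real (card R))"
        using K \<epsilon>_le \<open>B \<ge> 0\<close> by (intro add_mono mult_left_mono) auto
      finally show ?thesis .
    qed
    \<comment> \<open>The part of the error bound that does not grow with \<open>N\<close>; it
      disappears after division by \<open>N\<close>.\<close>
    define Q where "Q = I + 2 * B * K * real (card R)"
    have "(\<lambda>N. (\<Sum>n=1..N. c n * p (n mod M)) / of_nat N) \<longlonglongrightarrow> 0"
      using oscillating_averages_periodic[OF osc \<open>M > 0\<close>] .
    then have "\<forall>\<^sub>F N in sequentially. cmod ((\<Sum>n=1..N. c n * p (n mod M)) / of_nat N) < e / 4"
      using that by (intro order_tendstoD[OF tendsto_norm_zero]) auto
    moreover have "\<forall>\<^sub>F N in sequentially. Q / real N < e / 4"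
      using that by (intro order_tendstoD[OF lim_const_over_n]) auto
    ultimately have "\<forall>\<^sub>F N in sequentially. cmod ((\<Sum>n=1..N. c n * y n) / of_nat N) < e"
      using eventually_gt_at_top[of 0]
    proof eventually_elim
      case (elim N)
      have eq: "(\<Sum>n=1..N. c n * y n) / of_nat N = (\<Sum>n=1..N. c n * p (n mod M)) / of_nat N +
          (\<Sum>n=1..N. c n * (y n - p (n mod M))) / of_nat N"
        by (simp add: add_divide_distrib[symmetric] sum.distrib[symmetric] algebra_simps)
      moreover have "cmod ((\<Sum>n=1..N. c n * (y n - p (n mod M))) / of_nat N) \<le> e / 4 + Q / real N"
      proof -
        have "cmod (\<Sum>n=1..N. c n * (y n - p (n mod M))) \<le> (\<Sum>n=1..N. cmod (c n) * d n)"
          by (rule order_trans[OF norm_sum]) (simp add: norm_mult d_def)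
        also have "\<dots> \<le> real N * (e / 4) + Q" unfolding Q_def by (rule dsum)
        finally show ?thesis using elim by (simp add: norm_divide field_simps)
      qed
      moreover have "cmod ((\<Sum>n=1..N. c n * y n) / of_nat N) \<le>
          cmod ((\<Sum>n=1..N. c n * p (n mod M)) / of_nat N) +
          cmod ((\<Sum>n=1..N. c n * (y n - p (n mod M))) / of_nat N)"
        unfolding eq by (rule norm_triangle_ineq)
      ultimately show ?case using elim that by linarith
    qed
    then show ?thesis unfolding eventually_sequentially .
  qed
  then show ?thesis by (intro LIMSEQ_I) auto
qed

subsection \<open>Residue classes of times\<close>

lemma horseshoe_free_if_entropy_zero:
  assumes "continuous_on {a..b} f" "f \<in> {a..b} \<rightarrow> {a..b}" "topological_entropy {a..b} f = 0"
  shows "horseshoe_free a b f"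
proof
  fix p q r m n
  assume "a \<le> p" "p < q" "q < r" "r \<le> b" "0 < m" "0 < n"
    "{p..r} \<subseteq> (f ^^ m) ` {p..q}" "{p..r} \<subseteq> (f ^^ n) ` {q..r}"
  then show False
    using entropy_pos_if_horseshoe[OF assms(1,2)] assms(3) by fastforce
qed (use assms in auto)

lemma (in horseshoe_free) horseshoe_free_funpow:
  assumes "k > 0"
  shows "horseshoe_free a b (g ^^ k)"
proof
  show "continuous_on {a..b} (g ^^ k)" by (rule continuous_on_funpow[OF cont maps])
  show "g ^^ k \<in> {a..b} \<rightarrow> {a..b}" using iterate_in by blast
  fix p q r m n
  assume "a \<le> p" "p < q" "q < r" "r \<le> b" "0 < m" "0 < n"
    "{p..r} \<subseteq> ((g ^^ k) ^^ m) ` {p..q}" "{p..r} \<subseteq> ((g ^^ k) ^^ n) ` {q..r}"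
  then show False
    using no_horseshoe[of p q r "k * m" "k * n"] assms by (simp add: funpow_mult)
qed

text \<open>An alternating sequence cuts \<open>[u, v]\<close> at one point, so the two lengths add
  up to \<open>v - u\<close>. A convergent one is eventually in a short interval, which serves both
  parities and costs at most \<open>\<eta>\<close> in total.\<close>

lemma split_interval_by_parity:
  fixes y :: "nat \<Rightarrow> real"
  assumes y: "\<And>n. n \<ge> N \<Longrightarrow> y n \<in> {u..v}" and "\<eta> > 0"
    and dich: "convergent y \<or>
      (\<exists>z N. (\<forall>n\<ge>N. if even n then y n \<le> z else z \<le> y n) \<or>
             (\<forall>n\<ge>N. if even n then z \<le> y n else y n \<le> z))"
  shows "\<exists>N' l h. (\<forall>i<2. u \<le> l i \<and> l i \<le> h i \<and> h i \<le> v) \<and>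
    (\<forall>n\<ge>N'. y n \<in> {l (n mod 2)..h (n mod 2)}) \<and> (\<Sum>i<2::nat. h i - l i) \<le> v - u + \<eta>"
proof -
  have uv: "u \<le> v" using y[of N] by auto
  have parity: ?thesis
    if "\<And>n. n \<ge> N1 \<Longrightarrow> even n \<Longrightarrow> y n \<in> {l0..h0}" "\<And>n. n \<ge> N1 \<Longrightarrow> odd n \<Longrightarrow> y n \<in> {l1..h1}"
      "u \<le> l0" "l0 \<le> h0" "h0 \<le> v" "u \<le> l1" "l1 \<le> h1" "h1 \<le> v"
      "h0 - l0 + (h1 - l1) \<le> v - u + \<eta>" for N1 l0 h0 l1 h1
  proof -
    define l where "l i = (if i = 0 then l0 else l1)" for i :: nat
    define h where "h i = (if i = 0 then h0 else h1)" for i :: nat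
    have "y n \<in> {l (n mod 2)..h (n mod 2)}" if "n \<ge> N1" for n
      using \<open>\<And>n. n \<ge> N1 \<Longrightarrow> even n \<Longrightarrow> y n \<in> {l0..h0}\<close>[OF that]
        \<open>\<And>n. n \<ge> N1 \<Longrightarrow> odd n \<Longrightarrow> y n \<in> {l1..h1}\<close>[OF that]
      by (cases "even n") (auto simp: l_def h_def)
    moreover have "\<forall>i<2. u \<le> l i \<and> l i \<le> h i \<and> h i \<le> v"
      using that by (simp add: l_def h_def)
    moreover have "(\<Sum>i<2::nat. h i - l i) \<le> v - u + \<eta>"
      using that by (simp add: l_def h_def numeral_2_eq_2)
    ultimately show ?thesis by blast
  qed
  from dich show ?thesis
  proof (elim disjE exE)
    assume "convergent y"
    then obtain L where L: "y \<longlonglongrightarrow> L" unfolding convergent_def by blast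
    then have "L \<in> {u..v}"
      using y by (intro Lim_in_closed_set[of "{u..v}" y sequentially]) (auto simp: eventually_sequentially)
    obtain N1 where N1: "\<And>n. n \<ge> N1 \<Longrightarrow> \<bar>y n - L\<bar> < \<eta> / 4"
      using LIMSEQ_D[OF L, of "\<eta> / 4"] \<open>\<eta> > 0\<close> by auto
    have "y n \<in> {max u (L - \<eta> / 4)..min v (L + \<eta> / 4)}" if "n \<ge> max N N1" for n
      using abs_less_iff[THEN iffD1, OF N1[of n]] y[of n] that by auto
    moreover have "min v (L + \<eta> / 4) - max u (L - \<eta> / 4) \<le> \<eta> / 2"
      by (auto simp: min_def max_def)
    ultimately show ?thesis
      using \<open>L \<in> {u..v}\<close> \<open>\<eta> > 0\<close> uv
      by (intro parity[of "max N N1" "max u (L - \<eta> / 4)" "min v (L + \<eta> / 4)"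
            "max u (L - \<eta> / 4)" "min v (L + \<eta> / 4)"]) auto
  next
    fix z N1 assume alt: "\<forall>n\<ge>N1. if even n then y n \<le> z else z \<le> y n"
    \<comment> \<open>The separating point need not lie in \<open>[u, v]\<close>; clamping it keeps
      both pieces inside.\<close>
    define w where "w = max u (min v z)"
    have "y n \<in> {u..w}" if "n \<ge> max N N1" "even n" for n
      using alt[rule_format, of n] y[of n] that by (auto simp: w_def le_max_iff_disj)
    moreover have "y n \<in> {w..v}" if "n \<ge> max N N1" "odd n" for n
      using alt[rule_format, of n] y[of n] that by (auto simp: w_def min_le_iff_disj)
    moreover have "u \<le> w" "w \<le> v" using uv by (auto simp: w_def)
    ultimately show ?thesis
      using \<open>\<eta> > 0\<close> by (intro parity[of "max N N1" u w w v]) auto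
  next
    fix z N1 assume alt: "\<forall>n\<ge>N1. if even n then z \<le> y n else y n \<le> z"
    define w where "w = max u (min v z)"
    have "y n \<in> {w..v}" if "n \<ge> max N N1" "even n" for n
      using alt[rule_format, of n] y[of n] that by (auto simp: w_def min_le_iff_disj)
    moreover have "y n \<in> {u..w}" if "n \<ge> max N N1" "odd n" for n
      using alt[rule_format, of n] y[of n] that by (auto simp: w_def le_max_iff_disj)
    moreover have "u \<le> w" "w \<le> v" using uv by (auto simp: w_def)
    ultimately show ?thesis
      using \<open>\<eta> > 0\<close> by (intro parity[of "max N N1" w v u w]) auto
  qed
qed

lemma sum_lessThan_mult_2:
  fixes F :: "nat \<Rightarrow> nat \<Rightarrow> 'a::comm_monoid_add" and M :: nat
  shows "(\<Sum>r<M * 2. F (r mod M) (r div M)) = (\<Sum>r<M. \<Sum>i<2. F r i)"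
proof (cases "M = 0")
  case False
  have shift: "(\<Sum>r=M..<M+M. H r) = (\<Sum>r=0..<M. H (r + M))" for H :: "nat \<Rightarrow> 'a"
    using sum.shift_bounds_nat_ivl[of H 0 M M] by simp
  have "(\<Sum>r<M * 2. F (r mod M) (r div M)) = (\<Sum>r=0..<M+M. F (r mod M) (r div M))"
    by (simp only: lessThan_atLeast0 mult_2_right)
  also have "\<dots> = (\<Sum>r=0..<M. F (r mod M) (r div M)) + (\<Sum>r=M..<M+M. F (r mod M) (r div M))"
    by (rule sum.atLeastLessThan_concat[symmetric]) simp_all
  also have "\<dots> = (\<Sum>r=0..<M. F r 0 + F r 1)"
    unfolding shift using False by (simp add: sum.distrib)
  finally show ?thesis by (simp add: lessThan_atLeast0 numeral_2_eq_2)
qed simp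

context horseshoe_free
begin

text \<open>Induction doubling the modulus \<open>M\<close>: the times \<open>M * n + r\<close> are
  an orbit of \<open>g ^^ M\<close>, again horseshoe-free, so the dichotomy splits each class by the
  parity of \<open>n\<close>. Half of \<open>\<delta>\<close> is left to the induction hypothesis,
  the other half is shared equally by the \<open>M\<close> classes.\<close>

lemma residue_class_intervals:
  assumes x: "x \<in> {a..b}" and "\<delta> > 0"
  shows "\<exists>N u v. (\<forall>r<2 ^ k. a \<le> u r \<and> u r \<le> v r \<and> v r \<le> b) \<and>
    (\<forall>n\<ge>N. (g ^^ n) x \<in> {u (n mod 2 ^ k)..v (n mod 2 ^ k)}) \<and>
    (\<Sum>r<2 ^ k. v r - u r) \<le> b - a + \<delta>"
  using \<open>\<delta> > 0\<close>
proof (induction k arbitrary: \<delta>)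
  case 0
  then show ?case
    using x iterate_in[OF x] by (intro exI[of _ 0] exI[of _ "\<lambda>_. a"] exI[of _ "\<lambda>_. b"]) auto
next
  case (Suc k)
  define M :: nat where "M = 2 ^ k"
  have "M > 0" by (simp add: M_def)
  obtain N u v where uv: "\<And>r. r < M \<Longrightarrow> a \<le> u r \<and> u r \<le> v r \<and> v r \<le> b"
    and N: "\<And>n. n \<ge> N \<Longrightarrow> (g ^^ n) x \<in> {u (n mod M)..v (n mod M)}"
    and uv_sum: "(\<Sum>r<M. v r - u r) \<le> b - a + \<delta> / 2"
    using Suc.IH[of "\<delta> / 2"] Suc.prems unfolding M_def by auto
  define T where "T r N' l h \<longleftrightarrow> (\<forall>i<2. u r \<le> l i \<and> l i \<le> h i \<and> h i \<le> v r) \<and>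
      (\<forall>n\<ge>N'. (g ^^ (M * n + r)) x \<in> {l (n mod 2)..h (n mod 2)}) \<and>
      (\<Sum>i<2::nat. h i - l i) \<le> v r - u r + \<delta> / (2 * real M)" for r N' l h
  have "\<exists>N' l h. T r N' l h" if "r < M" for r
    unfolding T_def
  proof (rule split_interval_by_parity)
    interpret M: horseshoe_free a b "g ^^ M" using horseshoe_free_funpow[OF \<open>M > 0\<close>] .
    have iter: "((g ^^ M) ^^ n) ((g ^^ r) x) = (g ^^ (M * n + r)) x" for n
      by (simp add: funpow_mult funpow_add)
    show "convergent (\<lambda>n. (g ^^ (M * n + r)) x) \<or>
      (\<exists>z N. (\<forall>n\<ge>N. if even n then (g ^^ (M * n + r)) x \<le> z else z \<le> (g ^^ (M * n + r)) x) \<or>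
             (\<forall>n\<ge>N. if even n then z \<le> (g ^^ (M * n + r)) x else (g ^^ (M * n + r)) x \<le> z))"
      using M.orbit_dichotomy[OF iterate_in[OF x, of r]] unfolding iter .
    show "(g ^^ (M * n + r)) x \<in> {u r..v r}" if "n \<ge> N" for n
    proof -
      have "n \<le> M * n" using \<open>M > 0\<close> by simp
      then have "N \<le> M * n + r" using that by linarith
      then show ?thesis using N[of "M * n + r"] \<open>r < M\<close> by simp
    qed
  qed (use Suc.prems \<open>M > 0\<close> in simp)
  then have "\<forall>r. \<exists>N' l h. r < M \<longrightarrow> T r N' l h" by blast
  then obtain N' l h where T: "\<And>r. r < M \<Longrightarrow> T r (N' r) (l r) (h r)" by metis
  have lh: "u r \<le> l r i \<and> l r i \<le> h r i \<and> h r i \<le> v r" if "r < M" "i < 2" for r i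
    using T[OF \<open>r < M\<close>] \<open>i < 2\<close> unfolding T_def by blast
  have N': "(g ^^ (M * n + r)) x \<in> {l r (n mod 2)..h r (n mod 2)}" if "r < M" "N' r \<le> n" for r n
    using T[OF \<open>r < M\<close>] \<open>N' r \<le> n\<close> unfolding T_def by blast
  have lh_sum: "(\<Sum>i<2::nat. h r i - l r i) \<le> v r - u r + \<delta> / (2 * real M)" if "r < M" for r
    using T[OF that] unfolding T_def by blast
  \<comment> \<open>A residue \<open>r\<close> modulo \<open>M * 2\<close> encodes the old class
    \<open>r mod M\<close> and the parity \<open>r div M\<close> of the quotient.\<close>
  define U where "U r = l (r mod M) (r div M)" for r
  define V where "V r = h (r mod M) (r div M)" for r
  have UV: "a \<le> U r \<and> U r \<le> V r \<and> V r \<le> b" if "r < M * 2" for r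
    using lh[of "r mod M" "r div M"] uv[of "r mod M"] \<open>M > 0\<close> that
    by (auto simp: U_def V_def less_mult_imp_div_less mult.commute)
  have trapped: "(g ^^ n) x \<in> {U (n mod (M * 2))..V (n mod (M * 2))}"
    if "n \<ge> M * Max (N' ` {..<M})" for n
  proof -
    have "n mod M < M" using \<open>M > 0\<close> by simp
    then have "N' (n mod M) \<le> Max (N' ` {..<M})" by (intro Max_ge) auto
    also have "\<dots> \<le> n div M" using that \<open>M > 0\<close> by (simp add: less_eq_div_iff_mult_less_eq mult.commute)
    finally have "(g ^^ (M * (n div M) + n mod M)) x \<in> {l (n mod M) (n div M mod 2)..h (n mod M) (n div M mod 2)}"
      by (rule N'[OF \<open>n mod M < M\<close>])
    then show ?thesis
      using \<open>M > 0\<close> by (simp add: U_def V_def mod_mult2_eq)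
  qed
  have UV_sum: "(\<Sum>r<M * 2. V r - U r) \<le> b - a + \<delta>"
  proof -
    have "(\<Sum>r<M * 2. V r - U r) = (\<Sum>r<M. \<Sum>i<2. h r i - l r i)"
      unfolding U_def V_def by (rule sum_lessThan_mult_2[where F = "\<lambda>r i. h r i - l r i"])
    also have "\<dots> \<le> (\<Sum>r<M. v r - u r + \<delta> / (2 * real M))"
      using lh_sum by (intro sum_mono) auto
    also have "\<dots> = (\<Sum>r<M. v r - u r) + \<delta> / 2"
      using \<open>M > 0\<close> by (simp add: sum.distrib)
    finally show ?thesis using uv_sum by simp
  qed
  have M2: "2 ^ Suc k = M * 2" by (simp add: M_def)
  show ?case
    unfolding M2
  proof (intro exI conjI)
    show "\<forall>r<M * 2. a \<le> U r \<and> U r \<le> V r \<and> V r \<le> b" using UV by simp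
    show "\<forall>n\<ge>M * Max (N' ` {..<M}). (g ^^ n) x \<in> {U (n mod (M * 2))..V (n mod (M * 2))}"
      using trapped by blast
  qed (rule UV_sum)
qed

text \<open>The total length of the trapping intervals is at most \<open>b - a + 1\<close> whatever
  \<open>M\<close> is. So at most \<open>(b - a + 1) / d\<close> of them have length
  \<open>d\<close> or more, a small fraction of a large \<open>M\<close>. On the others
  \<open>\<phi>\<close> varies by less than \<open>\<epsilon>\<close> by uniform continuity.\<close>

lemma orbit_almost_periodic:
  fixes \<phi> :: "real \<Rightarrow> 'a::metric_space"
  assumes x: "x \<in> {a..b}" and \<phi>: "continuous_on {a..b} \<phi>" and "\<epsilon> > 0"
  shows "\<exists>M p R N. M > 0 \<and> R \<subseteq> {..<M} \<and> real (card R) \<le> \<epsilon> * real M \<and> (\<forall>r. p r \<in> {a..b}) \<and>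
    (\<forall>n\<ge>N. n mod M \<notin> R \<longrightarrow> dist (\<phi> ((g ^^ n) x)) (\<phi> (p (n mod M))) \<le> \<epsilon>)"
proof -
  have "uniformly_continuous_on {a..b} \<phi>"
    using compact_uniformly_continuous[OF \<phi>] by simp
  then obtain d where d: "d > 0"
    "\<And>s t. s \<in> {a..b} \<Longrightarrow> t \<in> {a..b} \<Longrightarrow> dist s t < d \<Longrightarrow> dist (\<phi> s) (\<phi> t) < \<epsilon>"
    using \<open>\<epsilon> > 0\<close> unfolding uniformly_continuous_on_def by metis
  obtain k where k: "(b - a + 1) / (d * \<epsilon>) < 2 ^ k"
    using real_arch_pow[of 2] by auto
  define M :: nat where "M = 2 ^ k"
  obtain N u v where uv: "\<And>r. r < M \<Longrightarrow> a \<le> u r \<and> u r \<le> v r \<and> v r \<le> b"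
    and N: "\<And>n. n \<ge> N \<Longrightarrow> (g ^^ n) x \<in> {u (n mod M)..v (n mod M)}"
    and uv_sum: "(\<Sum>r<M. v r - u r) \<le> b - a + 1"
    using residue_class_intervals[OF x, of 1 k] unfolding M_def by auto
  define R where "R = {r \<in> {..<M}. d \<le> v r - u r}"
  \<comment> \<open>The left endpoints serve as periodic approximants; the default \<open>a\<close>
    keeps every value in the interval, so that a bound for \<open>\<phi>\<close> there applies to
    all of them.\<close>
  define p where "p r = (if r < M then u r else a)" for r
  have "real (card R) * d = (\<Sum>r\<in>R. d)" by simp
  also have "\<dots> \<le> (\<Sum>r\<in>R. v r - u r)" by (intro sum_mono) (simp add: R_def)
  also have "\<dots> \<le> (\<Sum>r<M. v r - u r)" using uv by (intro sum_mono2) (auto simp: R_def)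
  also have "\<dots> \<le> b - a + 1" by (rule uv_sum)
  also have "\<dots> < real M * (d * \<epsilon>)"
    using k d \<open>\<epsilon> > 0\<close> by (simp add: M_def divide_less_eq)
  finally have card_R: "real (card R) \<le> \<epsilon> * real M" using d(1) by (simp add: mult_ac)
  have close: "dist (\<phi> ((g ^^ n) x)) (\<phi> (p (n mod M))) \<le> \<epsilon>" if "n \<ge> N" "n mod M \<notin> R" for n
  proof -
    have "n mod M < M" by (simp add: M_def)
    then have "dist ((g ^^ n) x) (p (n mod M)) < d" "p (n mod M) \<in> {a..b}"
      using N[OF that(1)] that(2) uv[of "n mod M"] by (auto simp: R_def p_def dist_real_def)
    then show ?thesis using d(2) iterate_in[OF x] by (simp add: less_imp_le)
  qed
  have p_in: "p r \<in> {a..b}" for r using uv[of r] x by (auto simp: p_def)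
  have "M > 0" "R \<subseteq> {..<M}" by (auto simp: M_def R_def)
  then show ?thesis
    using card_R close p_in by (intro exI[of _ M] exI[of _ p] exI[of _ R] exI[of _ N]) blast
qed

end

theorem corollary1:
  fixes c :: "nat \<Rightarrow> complex" and a b :: real and f :: "real \<Rightarrow> real"
  assumes "oscillating c"
    and "a \<le> b"
    and "continuous_on {a..b} f"
    and "f \<in> {a..b} \<rightarrow> {a..b}"
    and "topological_entropy {a..b} f = 0"
  shows "linearly_disjoint c {a..b} f"
  unfolding linearly_disjoint_def
proof (intro allI impI ballI)
  fix \<phi> :: "real \<Rightarrow> complex" and x
  assume \<phi>: "continuous_on {a..b} \<phi>" and x: "x \<in> {a..b}"
  interpret horseshoe_free a b f
    using horseshoe_free_if_entropy_zero assms by blast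
  have "bounded (\<phi> ` {a..b})"
    using compact_continuous_image[OF \<phi>] compact_imp_bounded by blast
  then obtain B where B: "\<And>t. t \<in> {a..b} \<Longrightarrow> cmod (\<phi> t) \<le> B"
    unfolding bounded_iff by blast
  show "(\<lambda>N. (\<Sum>n=1..N. c n * \<phi> ((f ^^ n) x)) / of_nat N) \<longlonglongrightarrow> 0"
  proof (rule oscillating_averages_almost_periodic[OF \<open>oscillating c\<close>])
    show "cmod (\<phi> ((f ^^ n) x)) \<le> B" for n using B iterate_in[OF x] .
    fix \<epsilon> :: real assume "\<epsilon> > 0"
    then obtain M p R N where *: "M > 0" "R \<subseteq> {..<M}" "real (card R) \<le> \<epsilon> * real M" "\<And>r. p r \<in> {a..b}"
      "\<And>n. n \<ge> N \<Longrightarrow> n mod M \<notin> R \<Longrightarrow> dist (\<phi> ((f ^^ n) x)) (\<phi> (p (n mod M))) \<le> \<epsilon>"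
      using orbit_almost_periodic[OF x \<phi>, of \<epsilon>] by metis
    show "\<exists>M p R N0. M > 0 \<and> R \<subseteq> {..<M} \<and> real (card R) \<le> \<epsilon> * real M \<and>
      (\<forall>r. cmod (p r) \<le> B) \<and> (\<forall>n\<ge>N0. n mod M \<notin> R \<longrightarrow> cmod (\<phi> ((f ^^ n) x) - p (n mod M)) \<le> \<epsilon>)"
      using * B by (intro exI[of _ M] exI[of _ "\<lambda>r. \<phi> (p r)"] exI[of _ R] exI[of _ N])
        (auto simp: dist_norm)
  qed
qed

end
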